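(* Let $q\ge 1$ be a fixed integer and let $a,b$ be real numbers with $b\neq 0$ and $b(q+1)-a\ge 2|b|\sqrt q$. Set $$c_{a,b}=\frac{2b\sqrt q}{b(q+1)-a},\qquad d_{a,b}=b(q+1)-a .$$ Consider on the $(q+1)$-regular tree $T_{q+1}$ with root $x_0$ the discrete wave equation $$\Delta_{q+1}^{a,b}W(x_0,x;t)+\partial_t^2W(x_0,x;t)=0,\qquad x\in V(T_{q+1}),\ t\in\mathbb N_0. \quad ( * )$$ (1) The solution of $( * )$ satisfying $W(x_0,x;0)=\delta_{x_0}(x)$ and $\partial_tW(x_0,x;0)=0$ for all $x\in V(T_{q+1})$, written as a function $W_{q+1}^{a,b}(r;t)$ of $r=d(x_0,x)$ and $t$, is $$W^{a,b}_{q+1}(r;t)=\sum_{k=0}^{\lfloor t/2\rfloor}(-1)^{k+r}\binom{t}{2k}d_{a,b}^k\left(q^{-\frac r2}I_r^{c_{a,b}}(k)-(q-1)\sum_{\ell=1}^{\lfloor\frac{k-r}{2}\rfloor}q^{-\frac{r+2\ell}{2}}I_{r+2\ell}^{c_{a,b}}(k)\right).$$ (2) The solution of $( * )$ (denoted $V$) satisfying $V(x_0,x;0)=0$ and $\partial_tV(x_0,x;0)=\delta_{x_0}(x)$ for all $x\in V(T_{q+1})$, written as a function $V_{q+1}^{a,b}(r;t)$ of $r=d(x_0,x)$ and $t$, is $$V^{a,b}_{q+1}(r;t)=\sum_{k=0}^{\lfloor (t-1)/2\rfloor}(-1)^{k+r}\binom{t}{2k+1}d_{a,b}^k\left(q^{-\frac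 r2}I_r^{c_{a,b}}(k)-(q-1)\sum_{\ell=1}^{\lfloor\frac{k-r}{2}\rfloor}q^{-\frac{r+2\ell}{2}}I_{r+2\ell}^{c_{a,b}}(k)\right).$$
   Context: $T_{q+1}$ is the $(q+1)$-regular tree (connected, $(q+1)$-regular, acyclic graph), $V(T_{q+1})$ its vertex set, $x_0$ a fixed vertex (root), $d$ the graph distance. $\delta_{x_0}(x)=1$ if $x=x_0$ and $0$ otherwise. The combinatorial Laplacian acts on $f:V(T_{q+1})\to\mathbb R$ by $\Delta_{T_{q+1}}f(x)=(q+1)f(x)-\sum_{y\sim x}f(y)$, and the generalized Laplacian is $\Delta_{q+1}^{a,b}=b\Delta_{T_{q+1}}-aI$; in $( * )$ it acts in the variable $x$. Time derivatives are forward differences: $\partial_tf(t)=f(t+1)-f(t)$, $\partial_t^2f(t)=f(t+2)-2f(t+1)+f(t)$. The solutions in question depend on $x$ only through $r=d(x_0,x)$. Discrete $I$-Bessel functions: for $t,n\in\mathbb N_0$ and $c\in\mathbb C$, $$I^{c}_{n}(t)=\sum_{\ell=0}^{\lfloor (t-n)/2\rfloor}\frac{t!}{\ell!\,(t-2\ell-n)!\,(n+\ell)!}\left(\frac c2\right)^{2\ell+n}\ \text{ if } n\le t,\qquad I_n^c(t)=0\ \text{ if } n>t.$$ Empty sums are zero. *)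

theory Defs
  imports Complex_Main "Graph_Theory.Graph_Theory"
begin

text \<open>
  Simple undirected graphs, possibly infinite, are bidirected loopfree pair digraphs: an edge
  \<open>{u, v}\<close> is the pair of arcs \<open>(u, v)\<close>, \<open>(v, u)\<close>. In this encoding \<open>u, v, u\<close> counts as a
  (directed) cycle, so acyclicity in the undirected sense forbids only cycles with at least three
  arcs. The predicates \<^const>\<open>forest\<close> and \<^const>\<open>tree\<close> of the library ignore this and
  are not applicable.
\<close>

locale regular_tree = pair_bidirected_digraph G
  for G :: "'v pair_pre_digraph" and k :: nat +
  assumes tree_connected: "connected G"
    and tree_acyclic: "\<not> (\<exists>p. cycle p \<and> 3 \<le> length p)"
    and tree_regular: "\<And>x. x \<in> pverts G \<Longrightarrow> finite (out_arcs G x) \<and> out_degree G x = k"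

definition graph_dist :: "'v pair_pre_digraph \<Rightarrow> 'v \<Rightarrow> 'v \<Rightarrow> nat" where
  "graph_dist G u v = (LEAST n. \<exists>p. pre_digraph.awalk G u p v \<and> length p = n)"

lemma (in pair_wf_digraph) mu_eq_graph_dist:
  assumes "u \<rightarrow>\<^sup>*\<^bsub>with_proj G\<^esub> v"
  shows "\<mu> (\<lambda>_. 1) u v = ereal (real (graph_dist G u v))"
proof -
  have cost: "awalk_cost (\<lambda>_. 1) p = real (length p)" for p :: "('a \<times> 'a) list"
    by (induction p) auto
  obtain p where p: "awalk u p v" using assms by (auto simp: reachable_awalk)
  have "\<exists>p. awalk u p v \<and> length p = graph_dist G u v"
    unfolding graph_dist_def by (rule LeastI_ex) (use p in blast)
  then obtain p\<^sub>0 where p\<^sub>0: "awalk u p\<^sub>0 v" "length p\<^sub>0 = graph_dist G u v" by blast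
  have le: "graph_dist G u v \<le> length p" if "awalk u p v" for p
    unfolding graph_dist_def by (rule Least_le) (use that in blast)
  show ?thesis
    unfolding \<mu>_def cost
  proof (rule INF_eqI)
    fix y :: ereal
    assume "\<And>p. p \<in> {p. awalk u p v} \<Longrightarrow> y \<le> ereal (real (length p))"
    from this[of p\<^sub>0] p\<^sub>0 show "y \<le> ereal (real (graph_dist G u v))" by simp
  qed (use le in auto)
qed

text \<open>Below, \<open>G\<close> is meant to be \<open>(q + 1)\<close>-regular, so its degree is written \<open>q + 1\<close>.\<close>

definition laplacian :: "'v pair_pre_digraph \<Rightarrow> nat \<Rightarrow> ('v \<Rightarrow> real) \<Rightarrow> 'v \<Rightarrow> real" where
  "laplacian G q f x = (real q + 1) * f x - (\<Sum>y | x \<rightarrow>\<^bsub>with_proj G\<^esub> y. f y)"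

definition gen_laplacian ::
  "'v pair_pre_digraph \<Rightarrow> nat \<Rightarrow> real \<Rightarrow> real \<Rightarrow> ('v \<Rightarrow> real) \<Rightarrow> 'v \<Rightarrow> real" where
  "gen_laplacian G q a b f x = b * laplacian G q f x - a * f x"

definition fwd_diff :: "(nat \<Rightarrow> real) \<Rightarrow> nat \<Rightarrow> real" where
  "fwd_diff f t = f (t + 1) - f t"

definition fwd_diff2 :: "(nat \<Rightarrow> real) \<Rightarrow> nat \<Rightarrow> real" where
  "fwd_diff2 f t = f (t + 2) - 2 * f (t + 1) + f t"

definition delta :: "'v \<Rightarrow> 'v \<Rightarrow> real" where
  "delta x\<^sub>0 x = (if x = x\<^sub>0 then 1 else 0)"

definition wave_equation ::
  "'v pair_pre_digraph \<Rightarrow> nat \<Rightarrow> real \<Rightarrow> real \<Rightarrow> ('v \<Rightarrow> nat \<Rightarrow> real) \<Rightarrow> bool" where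
  "wave_equation G q a b W \<longleftrightarrow>
     (\<forall>x\<in>pverts G. \<forall>t. gen_laplacian G q a b (\<lambda>y. W y t) x + fwd_diff2 (W x) t = 0)"

text \<open>
  \<open>bessel_I c n t\<close> is $I^{c}_{n}(t)$; it is polymorphic so as to cover both real and complex \<open>c\<close>.
\<close>

definition bessel_I :: "'a::field_char_0 \<Rightarrow> nat \<Rightarrow> nat \<Rightarrow> 'a" where
  "bessel_I c n t =
     (if n \<le> t then
        \<Sum>l = 0..(t - n) div 2.
          fact t / (fact l * fact (t - 2 * l - n) * fact (n + l)) * (c / 2) ^ (2 * l + n)
      else 0)"

definition d_coeff :: "nat \<Rightarrow> real \<Rightarrow> real \<Rightarrow> real" where
  "d_coeff q a b = b * (real q + 1) - a"

definition c_coeff :: "nat \<Rightarrow> real \<Rightarrow> real \<Rightarrow> real" where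
  "c_coeff q a b = 2 * b * sqrt (real q) / (b * (real q + 1) - a)"

text \<open>
  The parenthesised factor common to both solution formulas. For \<open>k < r\<close> the truncated
  subtraction yields the empty range \<open>{1..0}\<close>, as does the floor of the negative number
  \<open>(k - r) / 2\<close>.
\<close>

definition bessel_factor :: "nat \<Rightarrow> real \<Rightarrow> nat \<Rightarrow> nat \<Rightarrow> real" where
  "bessel_factor q c r k =
     real q powr (- (real r / 2)) * bessel_I c r k
     - (real q - 1) * (\<Sum>l = 1..(k - r) div 2.
         real q powr (- (real (r + 2 * l) / 2)) * bessel_I c (r + 2 * l) k)"

definition wave_W :: "nat \<Rightarrow> real \<Rightarrow> real \<Rightarrow> nat \<Rightarrow> nat \<Rightarrow> real" where
  "wave_W q a b r t =
     (\<Sum>k = 0..t div 2. (- 1) ^ (k + r) * real (t choose (2 * k)) * d_coeff q a b ^ k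
        * bessel_factor q (c_coeff q a b) r k)"

text \<open>
  The upper bound is the integer \<open>(int t - 1) div 2\<close>, so that for \<open>t = 0\<close> it is \<open>-1\<close> and the sum is
  empty.
\<close>

definition wave_V :: "nat \<Rightarrow> real \<Rightarrow> real \<Rightarrow> nat \<Rightarrow> nat \<Rightarrow> real" where
  "wave_V q a b r t =
     (\<Sum>k | int k \<le> (int t - 1) div 2.
        (- 1) ^ (k + r) * real (t choose (2 * k + 1)) * d_coeff q a b ^ k
        * bessel_factor q (c_coeff q a b) r k)"

end

theory Submission
  imports Defs
begin

text \<open>
  The wave equation says that the second forward difference in time equals the negative
  generalized Laplacian, and the second forward difference of \<open>t choose m\<close> is \<open>t choose (m - 2)\<close>. So
  for functions \<open>u k\<close> on the vertices each of which the negative Laplacian sends to the next one, the series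
  \<open>\<Sum>k. (t choose (2 * k)) * u k x\<close> and \<open>\<Sum>k. (t choose (2 * k + 1)) * u k x\<close> both solve the equation
  (\<open>wave_equation_binomial_series\<close>). At \<open>t = 0\<close> and \<open>t = 1\<close> only the term \<open>k = 0\<close> survives; with \<open>u 0\<close> the delta
  function at the root, the two series have the two prescribed sets of initial data. A solution is determined
  by these data (\<open>wave_equation_unique\<close>).

  It remains to see that the powers of the negative Laplacian, applied to the delta function, are the
  expressions with Bessel functions in the two formulas. They are radial, so two
  ingredients are compared. On the tree, the root has \<open>q + 1\<close> neighbours at
  distance \<open>1\<close>, and any other vertex at distance \<open>r\<close> has one neighbour at distance \<open>r - 1\<close> and \<open>q\<close> at distance
  \<open>r + 1\<close>; acyclicity enters through \<open>not_farther_neighbour_unique\<close>. On the analytic side, $I^{c}_{n}(k)$ is the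
  coefficient of $z^n$ in $(1 + \frac{c}{2}(z + z^{-1}))^k$, whence a three-term recurrence in \<open>n\<close>. Scaled by
  $q^{-n/2}$ it becomes the radial recurrence on the tree away from the root. At the root it
  has the wrong weight \<open>2 * q\<close>, and the sum with weight \<open>q - 1\<close> corrects that to \<open>q + 1\<close>
  (\<open>bessel_factor_0_Suc\<close>). The hypothesis on \<open>a\<close> and \<open>b\<close> makes the denominator \<open>d_coeff q a b\<close> nonzero.
\<close>


section \<open>Discrete Bessel functions\<close>

text \<open>
  The trinomial coefficient splits into two binomials, and the first of them vanishes as soon as
  \<open>2 * l + n\<close> exceeds \<open>t\<close>. The upper limit can therefore be any \<open>N \<ge> t\<close>, so that values at different
  \<open>n\<close> and \<open>t\<close> can be compared term by term. In this form \<open>bessel_I c n t\<close> is visibly the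
  coefficient of $z^n$ in $(1 + \frac{c}{2}(z + z^{-1}))^t$.
\<close>

lemma bessel_I_eq_binomial_sum:
  fixes c :: "'a::field_char_0"
  assumes "t \<le> N"
  shows "bessel_I c n t =
    (\<Sum>l\<le>N. of_nat (t choose (2 * l + n)) * of_nat ((2 * l + n) choose l) * (c / 2) ^ (2 * l + n))"
    (is "_ = (\<Sum>l\<le>N. ?f l)")
proof (cases "n \<le> t")
  case True
  have *: "fact t / (fact l * fact (t - 2 * l - n) * fact (n + l)) * (c / 2) ^ (2 * l + n) = ?f l"
    if "l \<le> (t - n) div 2" for l
  proof -
    have le: "2 * l + n \<le> t" using that True by linarith
    have idx: "2 * l + n - l = n + l" "t - (2 * l + n) = t - 2 * l - n" by simp_all
    have outer: "of_nat (t choose (2 * l + n))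
        = (fact t / (fact (2 * l + n) * fact (t - 2 * l - n)) :: 'a)"
      using binomial_fact[OF le, where 'a = 'a] unfolding idx .
    have inner: "of_nat ((2 * l + n) choose l) = (fact (2 * l + n) / (fact l * fact (n + l)) :: 'a)"
      using binomial_fact[of l "2 * l + n", where 'a = 'a] unfolding idx by simp
    have "x / (y * z * w) = x / (f * z) * (f / (y * w))" if "f \<noteq> 0" for x y z w f :: 'a
      using that by simp
    then show ?thesis unfolding outer inner by (metis fact_nonzero)
  qed
  have "bessel_I c n t = (\<Sum>l = 0..(t - n) div 2. ?f l)"
    using True * by (simp add: bessel_I_def)
  also have "\<dots> = (\<Sum>l\<le>N. ?f l)"
  proof (rule sum.mono_neutral_left)
    show "\<forall>l\<in>{..N} - {0..(t - n) div 2}. ?f l = 0"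
    proof
      fix l assume "l \<in> {..N} - {0..(t - n) div 2}"
      then have "t < 2 * l + n" using True by auto
      then show "?f l = 0" by (simp add: binomial_eq_0)
    qed
  qed (use assms in auto)
  finally show ?thesis .
next
  case False
  then have "?f l = 0" for l by (simp add: binomial_eq_0)
  then have "(\<Sum>l\<le>N. ?f l) = 0" by (intro sum.neutral ballI)
  with False show ?thesis by (simp add: bessel_I_def)
qed

text \<open>
  Multiplying the generating polynomial once more by $1 + \frac{c}{2}(z + z^{-1})$ replaces the
  \<open>n\<close>-th coefficient by itself plus \<open>c / 2\<close> times the sum of its two neighbours. At \<open>n = 0\<close> the
  neighbours with indices \<open>1\<close> and \<open>-1\<close> coincide by symmetry, which doubles the contribution. In terms of
  binomials this is Pascal's rule for the outer binomial, together with the fact that the central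
  binomial is twice the one before it.
\<close>

lemma bessel_I_0_Suc:
  fixes c :: "'a::field_char_0"
  shows "bessel_I c 0 (Suc t) = bessel_I c 0 t + c * bessel_I c 1 t"
proof -
  let ?C = "\<lambda>n k. of_nat (n choose k) :: 'a"
  have pascal: "?C (Suc t) (2 * l + 2) = ?C t (2 * l + 2) + ?C t (2 * l + 1)" for l
    by simp
  have central: "?C (2 * l + 2) (Suc l) = 2 * ?C (2 * l + 1) l" for l
  proof -
    have "Suc (2 * l + 1) choose Suc l = 2 * ((2 * l + 1) choose l)"
      using binomial_symmetric[of "Suc l" "2 * l + 1"] by simp
    then have "?C (Suc (2 * l + 1)) (Suc l) = of_nat (2 * ((2 * l + 1) choose l))" by (rule arg_cong)
    then show ?thesis by (simp del: binomial_Suc_Suc)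
  qed
  have double: "x * (2 * y) * (c / 2) ^ (2 * l + 2) = c * (x * y * (c / 2) ^ (2 * l + 1))"
    for x y :: 'a and l by simp
  have "bessel_I c 0 (Suc t) = 1 + (\<Sum>l\<le>t. ?C (Suc t) (2 * l + 2) * ?C (2 * l + 2) (Suc l) * (c / 2) ^ (2 * l + 2))"
    by (subst bessel_I_eq_binomial_sum[where N = "Suc t"]) (simp_all add: sum.atMost_Suc_shift del: sum.atMost_Suc binomial_Suc_Suc)
  also have "\<dots> = (1 + (\<Sum>l\<le>t. ?C t (2 * l + 2) * ?C (2 * l + 2) (Suc l) * (c / 2) ^ (2 * l + 2)))
      + (\<Sum>l\<le>t. ?C t (2 * l + 1) * ?C (2 * l + 2) (Suc l) * (c / 2) ^ (2 * l + 2))"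
    by (simp only: pascal distrib_right sum.distrib add.assoc)
  also have "1 + (\<Sum>l\<le>t. ?C t (2 * l + 2) * ?C (2 * l + 2) (Suc l) * (c / 2) ^ (2 * l + 2))
      = bessel_I c 0 t"
    by (subst bessel_I_eq_binomial_sum[where N = "Suc t"]) (simp_all add: sum.atMost_Suc_shift del: sum.atMost_Suc binomial_Suc_Suc)
  also have "(\<Sum>l\<le>t. ?C t (2 * l + 1) * ?C (2 * l + 2) (Suc l) * (c / 2) ^ (2 * l + 2))
      = c * bessel_I c 1 t"
    unfolding bessel_I_eq_binomial_sum[OF order_refl] sum_distrib_left central double ..
  finally show ?thesis .
qed

text \<open>
  Away from \<open>n = 0\<close> Pascal's rule is used twice: on the outer binomial it splits off the value at \<open>t\<close>, and
  on the inner one it separates the contributions of the lower and the upper neighbour.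
\<close>

lemma bessel_I_Suc_Suc:
  fixes c :: "'a::field_char_0"
  shows "bessel_I c (Suc n) (Suc t) =
    bessel_I c (Suc n) t + c / 2 * (bessel_I c n t + bessel_I c (Suc (Suc n)) t)"
proof -
  let ?C = "\<lambda>n k. of_nat (n choose k) :: 'a"
  have "bessel_I c (Suc n) (Suc t)
      = (\<Sum>l\<le>Suc t. ?C t (2 * l + Suc n) * ?C (2 * l + Suc n) l * (c / 2) ^ (2 * l + Suc n))
      + (\<Sum>l\<le>Suc t. ?C t (2 * l + n) * ?C (Suc (2 * l + n)) l * (c / 2) ^ (2 * l + Suc n))"
    by (subst bessel_I_eq_binomial_sum[where N = "Suc t"])
      (simp_all add: sum.distrib[symmetric] algebra_simps del: sum.atMost_Suc)
  also have "(\<Sum>l\<le>Suc t. ?C t (2 * l + Suc n) * ?C (2 * l + Suc n) l * (c / 2) ^ (2 * l + Suc n))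
      = bessel_I c (Suc n) t"
    by (subst bessel_I_eq_binomial_sum[where N = "Suc t"]) simp_all
  also have "(\<Sum>l\<le>Suc t. ?C t (2 * l + n) * ?C (Suc (2 * l + n)) l * (c / 2) ^ (2 * l + Suc n))
      = ?C t n * (c / 2) ^ Suc n
        + (\<Sum>l\<le>t. ?C t (2 * l + n + 2) * (?C (2 * l + n + 2) (Suc l) + ?C (2 * l + n + 2) l)
            * (c / 2) ^ Suc (2 * l + n + 2))"
    by (subst sum.atMost_Suc_shift) (simp add: algebra_simps)
  also have "\<dots> = c / 2 * (?C t n * (c / 2) ^ n
        + (\<Sum>l\<le>t. ?C t (2 * l + n + 2) * ?C (2 * l + n + 2) (Suc l) * (c / 2) ^ (2 * l + n + 2)))
      + c / 2 * (\<Sum>l\<le>t. ?C t (2 * l + n + 2) * ?C (2 * l + n + 2) l * (c / 2) ^ (2 * l + n + 2))"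
    by (simp only: power_Suc distrib_left distrib_right sum.distrib sum_distrib_left mult_ac add_ac)
  also have "?C t n * (c / 2) ^ n
        + (\<Sum>l\<le>t. ?C t (2 * l + n + 2) * ?C (2 * l + n + 2) (Suc l) * (c / 2) ^ (2 * l + n + 2))
      = bessel_I c n t"
    by (subst bessel_I_eq_binomial_sum[where N = "Suc t"])
      (simp_all add: sum.atMost_Suc_shift del: sum.atMost_Suc binomial_Suc_Suc)
  also have "(\<Sum>l\<le>t. ?C t (2 * l + n + 2) * ?C (2 * l + n + 2) l * (c / 2) ^ (2 * l + n + 2))
      = bessel_I c (Suc (Suc n)) t"
    by (subst bessel_I_eq_binomial_sum[OF order_refl]) simp
  finally show ?thesis by (simp add: algebra_simps)
qed

lemma bessel_I_eq_0: "t < n \<Longrightarrow> bessel_I c n t = 0"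
  by (simp add: bessel_I_def)

lemma bessel_I_at_0: "bessel_I c n 0 = (if n = 0 then 1 else 0)"
  by (simp add: bessel_I_def)


section \<open>The radial kernel\<close>

text \<open>
  This is $q^{-n/2} I^{c}_{n}(k)$. The power of \<open>q\<close> makes the Bessel recurrence weigh the two neighbours in the ratio
  \<open>1 : q\<close>, which is the ratio of the numbers of neighbours towards and away from the root.
\<close>

definition scaled_bessel :: "nat \<Rightarrow> real \<Rightarrow> nat \<Rightarrow> nat \<Rightarrow> real" where
  "scaled_bessel q c n k = bessel_I c n k / sqrt (real q) ^ n"

text \<open>
  Since \<open>bessel_I c n k\<close> vanishes for \<open>n > k\<close>, the sum may run up to a common bound \<open>N\<close>, in place of a bound
  that changes with \<open>r\<close> and \<open>k\<close>.
\<close>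

lemma bessel_factor_eq_scaled_bessel:
  assumes "q \<ge> 1" and "k \<le> N"
  shows "bessel_factor q c r k =
    scaled_bessel q c r k - (real q - 1) * (\<Sum>l = 1..N. scaled_bessel q c (r + 2 * l) k)"
proof -
  have powr: "real q powr (- (real n / 2)) * bessel_I c n k = scaled_bessel q c n k" for n
  proof -
    have "real q powr (real n / 2) = sqrt (real q) ^ n"
      using assms(1) by (simp add: powr_half_sqrt[symmetric] powr_powr powr_realpow[symmetric])
    then show ?thesis
      by (simp add: powr_minus scaled_bessel_def field_simps)
  qed
  have "(\<Sum>l = 1..(k - r) div 2. scaled_bessel q c (r + 2 * l) k)
      = (\<Sum>l = 1..N. scaled_bessel q c (r + 2 * l) k)"
  proof (rule sum.mono_neutral_left)
    show "\<forall>l\<in>{1..N} - {1..(k - r) div 2}. scaled_bessel q c (r + 2 * l) k = 0"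
    proof
      fix l assume "l \<in> {1..N} - {1..(k - r) div 2}"
      then have "k < r + 2 * l" by auto
      then show "scaled_bessel q c (r + 2 * l) k = 0"
        by (simp add: scaled_bessel_def bessel_I_eq_0)
    qed
  qed (use assms in auto)
  then show ?thesis unfolding bessel_factor_def powr by simp
qed

lemma scaled_bessel_0_Suc:
  assumes "q \<ge> 1"
  shows "scaled_bessel q c 0 (Suc k) =
    scaled_bessel q c 0 k + c / (2 * sqrt (real q)) * (2 * real q * scaled_bessel q c 1 k)"
proof -
  have "real q = sqrt (real q) * sqrt (real q)" "sqrt (real q) > 0" using assms by simp_all
  then show ?thesis
    unfolding scaled_bessel_def bessel_I_0_Suc by (simp add: field_simps)
qed

lemma scaled_bessel_Suc_Suc:
  assumes "q \<ge> 1"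
  shows "scaled_bessel q c (Suc n) (Suc k) = scaled_bessel q c (Suc n) k
    + c / (2 * sqrt (real q)) * (scaled_bessel q c n k + real q * scaled_bessel q c (Suc (Suc n)) k)"
proof -
  have "real q = sqrt (real q) * sqrt (real q)" "sqrt (real q) > 0" using assms by simp_all
  then show ?thesis
    unfolding scaled_bessel_def bessel_I_Suc_Suc by (simp add: field_simps)
qed

text \<open>
  The recurrence of the scaled Bessel functions is linear and invariant under index shifts away from
  index \<open>0\<close>, so it passes to the combination of them that makes up the factor.
\<close>

lemma bessel_factor_Suc_Suc:
  assumes "q \<ge> 1"
  shows "bessel_factor q c (Suc r) (Suc k) = bessel_factor q c (Suc r) k
    + c / (2 * sqrt (real q)) * (bessel_factor q c r k + real q * bessel_factor q c (Suc (Suc r)) k)"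
proof -
  define \<beta> where "\<beta> = c / (2 * sqrt (real q))"
  note expand = bessel_factor_eq_scaled_bessel[OF assms, where N = "Suc k"]
  note step = scaled_bessel_Suc_Suc[OF assms, of c, folded \<beta>_def]
  show ?thesis
    unfolding \<beta>_def[symmetric]
    by (simp add: expand step sum.distrib sum_distrib_left algebra_simps
        del: sum.cl_ivl_Suc)
qed

text \<open>
  This is where the correction sum with weight \<open>q - 1\<close> is needed. The leading term alone would give the root the
  weight \<open>2 * q\<close> for its neighbours. Each even index in the correction sum contributes the two adjacent odd indices;
  each odd index from \<open>3\<close> on is then met twice, with total weight \<open>q + 1\<close>, while index \<open>1\<close> is met once, with
  weight \<open>1\<close>. This single term lowers the weight of index \<open>1\<close> from \<open>2 * q\<close> to \<open>2 * q - (q - 1) = q + 1\<close>, the degree of the root.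
\<close>

lemma bessel_factor_0_Suc:
  assumes "q \<ge> 1"
  shows "bessel_factor q c 0 (Suc k) = bessel_factor q c 0 k
    + c / (2 * sqrt (real q)) * ((real q + 1) * bessel_factor q c 1 k)"
proof -
  let ?J = "\<lambda>n. scaled_bessel q c n k"
  define \<beta> where "\<beta> = c / (2 * sqrt (real q))"
  define S where "S = (\<Sum>l = 1..Suc k. ?J (1 + 2 * l))"
  note expand = bessel_factor_eq_scaled_bessel[OF assms, where N = "Suc k"]
  have step: "scaled_bessel q c (2 * l) (Suc k)
      = ?J (2 * l) + \<beta> * (?J (1 + 2 * (l - 1)) + real q * ?J (1 + 2 * l))" if "l \<in> {1..Suc k}" for l
    using that scaled_bessel_Suc_Suc[OF assms, of c "1 + 2 * (l - 1)" k, folded \<beta>_def]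
    by (cases l) simp_all
  \<comment> \<open>The term added at \<open>l = Suc k\<close> in the second step has index above \<open>k\<close> and is zero.\<close>
  have "(\<Sum>l = 1..Suc k. ?J (1 + 2 * (l - 1))) = (\<Sum>l = 0..k. ?J (1 + 2 * l))"
    by (rule sum.reindex_bij_witness[where i = Suc and j = "\<lambda>l. l - 1"]) auto
  also have "\<dots> = (\<Sum>l = 0..Suc k. ?J (1 + 2 * l))"
    by (simp add: scaled_bessel_def bessel_I_eq_0)
  also have "\<dots> = ?J 1 + S"
    unfolding S_def by (simp add: sum.atLeast_Suc_atMost[of 0] del: sum.cl_ivl_Suc)
  finally have shift: "(\<Sum>l = 1..Suc k. ?J (1 + 2 * (l - 1))) = ?J 1 + S" .
  have even: "(\<Sum>l = 1..Suc k. scaled_bessel q c (2 * l) (Suc k))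
      = (\<Sum>l = 1..Suc k. ?J (2 * l)) + \<beta> * (?J 1 + S + real q * S)"
  proof -
    have "(\<Sum>l = 1..Suc k. scaled_bessel q c (2 * l) (Suc k))
        = (\<Sum>l = 1..Suc k. ?J (2 * l) + \<beta> * (?J (1 + 2 * (l - 1)) + real q * ?J (1 + 2 * l)))"
      by (rule sum.cong[OF refl step])
    also have "\<dots> = (\<Sum>l = 1..Suc k. ?J (2 * l))
        + \<beta> * ((\<Sum>l = 1..Suc k. ?J (1 + 2 * (l - 1))) + real q * S)"
      unfolding S_def by (simp only: sum.distrib sum_distrib_left[symmetric])
    finally show ?thesis unfolding shift .
  qed
  have F0: "bessel_factor q c 0 (Suc k) = scaled_bessel q c 0 (Suc k)
      - (real q - 1) * (\<Sum>l = 1..Suc k. scaled_bessel q c (2 * l) (Suc k))"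
    and F: "bessel_factor q c 0 k = ?J 0 - (real q - 1) * (\<Sum>l = 1..Suc k. ?J (2 * l))"
    and F1: "bessel_factor q c 1 k = ?J 1 - (real q - 1) * S"
    using expand[of "Suc k" c 0] expand[of k c 0] expand[of k c 1] unfolding S_def by simp_all
  show ?thesis
    unfolding F0 F F1 even scaled_bessel_0_Suc[OF assms] \<beta>_def[symmetric]
    by (simp add: algebra_simps del: sum.cl_ivl_Suc)
qed

lemma bessel_factor_at_0: "q \<ge> 1 \<Longrightarrow> bessel_factor q c r 0 = (if r = 0 then 1 else 0)"
  by (simp add: bessel_factor_def bessel_I_at_0)

text \<open>
  As a function of the distance \<open>r\<close> to the root, this is the \<open>k\<close>-th power of the negative generalized Laplacian
  applied to the delta function at the root.
\<close>

definition laplace_mode :: "nat \<Rightarrow> real \<Rightarrow> real \<Rightarrow> nat \<Rightarrow> nat \<Rightarrow> real" where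
  "laplace_mode q a b k r =
     (- 1) ^ (k + r) * d_coeff q a b ^ k * bessel_factor q (c_coeff q a b) r k"

text \<open>
  The right-hand sides are \<open>b\<close> times the adjacency operator minus \<open>d_coeff q a b\<close>, that is, the negative generalized
  Laplacian, acting on radial functions. The constant \<open>c_coeff\<close> is chosen such that the Bessel step size
  \<open>c / (2 * sqrt q)\<close> equals \<open>b / d\<close>; the sign \<open>(- 1) ^ (k + r)\<close> changes when \<open>k\<close> alone is raised but
  not when \<open>r\<close> moves along with it, which gives the two terms their opposite signs.
\<close>

lemma laplace_mode_Suc:
  assumes "q \<ge> 1" and "d_coeff q a b \<noteq> 0"
  shows "laplace_mode q a b (Suc k) 0 =
      b * ((real q + 1) * laplace_mode q a b k 1) - d_coeff q a b * laplace_mode q a b k 0"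
    and "laplace_mode q a b (Suc k) (Suc r) =
      b * (laplace_mode q a b k r + real q * laplace_mode q a b k (Suc (Suc r)))
      - d_coeff q a b * laplace_mode q a b k (Suc r)"
proof -
  have ratio: "c_coeff q a b / (2 * sqrt (real q)) = b / d_coeff q a b"
  proof -
    have "c_coeff q a b = 2 * b * sqrt (real q) / d_coeff q a b"
      by (simp add: c_coeff_def d_coeff_def)
    then show ?thesis using assms(1) by simp
  qed
  show "laplace_mode q a b (Suc k) 0 =
      b * ((real q + 1) * laplace_mode q a b k 1) - d_coeff q a b * laplace_mode q a b k 0"
    unfolding laplace_mode_def bessel_factor_0_Suc[OF assms(1)] ratio
    using assms(2) by (simp add: field_simps)
  show "laplace_mode q a b (Suc k) (Suc r) =
      b * (laplace_mode q a b k r + real q * laplace_mode q a b k (Suc (Suc r)))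
      - d_coeff q a b * laplace_mode q a b k (Suc r)"
    unfolding laplace_mode_def bessel_factor_Suc_Suc[OF assms(1)] ratio
    using assms(2) by (simp add: field_simps)
qed


section \<open>Spheres in the regular tree\<close>

context regular_tree
begin

lemma geodesic_exists:
  assumes "u \<in> pverts G" "v \<in> pverts G"
  obtains p where "awalk u p v" "length p = graph_dist G u v"
proof -
  have "u \<rightarrow>\<^sup>*\<^bsub>mk_symmetric G\<^esub> v"
    using tree_connected assms unfolding connected_def by (auto elim!: strongly_connectedE)
  then have "u \<rightarrow>\<^sup>*\<^bsub>with_proj G\<^esub> v" by (simp only: reachable_mk_symmetric_eq[OF sym_arcs])
  then obtain p where "awalk u p v" by (auto simp: reachable_awalk)
  then have "\<exists>n. \<exists>p. awalk u p v \<and> length p = n" by blast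
  then have "\<exists>p. awalk u p v \<and> length p = graph_dist G u v"
    unfolding graph_dist_def by (rule LeastI_ex)
  then show ?thesis using that by blast
qed

lemma graph_dist_le: "awalk u p v \<Longrightarrow> graph_dist G u v \<le> length p"
  unfolding graph_dist_def by (rule Least_le) blast

lemma graph_dist_eq_0_iff:
  assumes "u \<in> pverts G" "v \<in> pverts G"
  shows "graph_dist G u v = 0 \<longleftrightarrow> v = u"
proof
  assume "graph_dist G u v = 0"
  then show "v = u" using geodesic_exists[OF assms] by (auto simp: awalk_Nil_iff)
next
  assume "v = u"
  then show "graph_dist G u v = 0" using graph_dist_le[of u "[]" v] assms by (auto simp: awalk_Nil_iff)
qed

lemma graph_dist_arc_le:
  assumes "u \<in> pverts G" "(x, y) \<in> parcs G"
  shows "graph_dist G u y \<le> Suc (graph_dist G u x)"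
proof -
  have "x \<in> pverts G" using assms by (auto dest: wellformed')
  then obtain p where p: "awalk u p x" "length p = graph_dist G u x"
    using geodesic_exists assms by blast
  have "awalk u (p @ [(x, y)]) y"
    using p assms by (auto simp: awalk_simps dest: wellformed')
  from graph_dist_le[OF this] p show ?thesis by simp
qed

text \<open>
  Every vertex of a geodesic other than its end is strictly closer to the start than that end.
\<close>

lemma geodesic_avoids:
  assumes "awalk u p y" "length p = graph_dist G u y"
    and "graph_dist G u y \<le> graph_dist G u x" "y \<noteq> x"
  shows "x \<notin> set (awalk_verts u p)"
proof
  assume "x \<in> set (awalk_verts u p)"
  then obtain q r where qr: "p = q @ r" "awalk u q x" "awalk x r y"
    using awalk_decomp[OF assms(1)] by blast
  have "length q + length r = graph_dist G u y" using assms(2) qr(1) by simp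
  then have "length r = 0" using graph_dist_le[OF qr(2)] assms(3) by linarith
  then have "r = []" by simp
  then show False using qr assms by (simp add: awalk_Nil_iff)
qed

text \<open>
  If \<open>y\<close> and \<open>z\<close> were distinct, a path from \<open>y\<close> to \<open>z\<close> that avoids \<open>x\<close> could be closed through \<open>x\<close> to a
  cycle with at least three arcs.
\<close>

lemma avoiding_walk_imp_neighbours_eq:
  assumes "(x, y) \<in> parcs G" "(x, z) \<in> parcs G"
    and p: "awalk y p z" "x \<notin> set (awalk_verts y p)"
  shows "y = z"
proof (rule ccontr)
  assume "y \<noteq> z"
  define s where "s = awalk_to_apath p"
  have s: "awalk y s z" "distinct (awalk_verts y s)"
    using apath_awalk_to_apath[OF p(1)] by (auto simp: s_def apath_def)
  have "set s \<subseteq> set p" unfolding s_def by (rule awalk_to_apath_subset[OF p(1)])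
  then have xs: "x \<notin> set (awalk_verts y s)"
    using p set_awalk_verts[OF p(1)] set_awalk_verts[OF s(1)] by auto
  have "s \<noteq> []" using s \<open>y \<noteq> z\<close> by (auto simp: awalk_Nil_iff)
  have zx: "awalk z [(z, x)] x"
    using assms(2) by (auto simp: awalk_simps dest: wellformed' arcs_symmetric)
  have yx: "awalk y (s @ [(z, x)]) x" using s(1) zx by simp
  then have "awalk x ((x, y) # s @ [(z, x)]) x"
    using assms(1) by (auto simp: awalk_Cons_iff dest: wellformed')
  moreover have "tl (awalk_verts x ((x, y) # s @ [(z, x)])) = awalk_verts y s @ [x]"
    using awalk_verts_append[OF yx] s(1) by simp
  ultimately have "cycle ((x, y) # s @ [(z, x)])"
    unfolding cycle_def using s(2) xs by (intro exI[of _ x]) simp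
  moreover have "3 \<le> length ((x, y) # s @ [(z, x)])" using \<open>s \<noteq> []\<close> by (cases s) simp_all
  ultimately show False using tree_acyclic by blast
qed

text \<open>
  Geodesics from \<open>u\<close> to two such neighbours avoid \<open>x\<close>, and joined at \<open>u\<close> they connect the neighbours. The
  non-strict inequalities matter: they also exclude a neighbour at the same distance as \<open>x\<close>
  next to the one on the geodesic to \<open>x\<close>.
\<close>

lemma not_farther_neighbour_unique:
  assumes u: "u \<in> pverts G" and xy: "(x, y) \<in> parcs G" and xz: "(x, z) \<in> parcs G"
    and "graph_dist G u y \<le> graph_dist G u x" "graph_dist G u z \<le> graph_dist G u x"
  shows "y = z"
proof -
  have neq: "y \<noteq> x" "z \<noteq> x" using no_loops[OF xy] no_loops[OF xz] by auto
  obtain p where p: "awalk u p y" "length p = graph_dist G u y"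
    using geodesic_exists u xy by (blast dest: wellformed')
  obtain p' where p': "awalk u p' z" "length p' = graph_dist G u z"
    using geodesic_exists u xz by (blast dest: wellformed')
  have rev: "awalk y (rev_path p) u" using p by simp
  then have walk: "awalk y (rev_path p @ p') z" using p' by simp
  have "x \<notin> set (awalk_verts y (rev_path p @ p'))"
    using set_awalk_verts_append[OF rev p'(1)] awalk_verts_rev_path[OF p(1)]
      geodesic_avoids[OF p assms(4) neq(1)] geodesic_avoids[OF p' assms(5) neq(2)]
    by simp
  with avoiding_walk_imp_neighbours_eq[OF xy xz walk] show ?thesis by blast
qed

lemma closer_neighbour_exists:
  assumes "u \<in> pverts G" "x \<in> pverts G" "graph_dist G u x = Suc r"
  obtains y where "(x, y) \<in> parcs G" "graph_dist G u y = r"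
proof -
  obtain p where p: "awalk u p x" "length p = Suc r"
    using geodesic_exists assms by metis
  then obtain p' e where e: "p = p' @ [e]" by (metis length_Suc_conv_rev)
  with p have walk: "awalk u p' (fst e)" and arc: "(fst e, x) \<in> parcs G"
    by (auto simp: awalk_simps)
  have "graph_dist G u (fst e) \<le> r" using graph_dist_le[OF walk] e p by simp
  moreover have "Suc r \<le> Suc (graph_dist G u (fst e))"
    using graph_dist_arc_le[OF assms(1) arc] assms(3) by simp
  ultimately show ?thesis using that arcs_symmetric[OF arc] by simp
qed

lemma finite_neighbours: "x \<in> pverts G \<Longrightarrow> finite {y. (x, y) \<in> parcs G}"
  and card_neighbours: "x \<in> pverts G \<Longrightarrow> card {y. (x, y) \<in> parcs G} = k"
proof -
  assume x: "x \<in> pverts G"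
  have eq: "{y. (x, y) \<in> parcs G} = snd ` out_arcs G x" by (force simp: out_arcs_def)
  have inj: "inj_on snd (out_arcs G x)" by (auto simp: inj_on_def out_arcs_def)
  show "finite {y. (x, y) \<in> parcs G}" unfolding eq using tree_regular[OF x] by simp
  show "card {y. (x, y) \<in> parcs G} = k"
    unfolding eq card_image[OF inj] using tree_regular[OF x] by (simp add: out_degree_def)
qed

lemma sum_neighbours_root:
  fixes f :: "nat \<Rightarrow> real"
  assumes "u \<in> pverts G"
  shows "(\<Sum>y | (u, y) \<in> parcs G. f (graph_dist G u y)) = real k * f 1"
proof -
  have "graph_dist G u y = 1" if "(u, y) \<in> parcs G" for y
  proof -
    have "graph_dist G u u = 0" using assms by (simp add: graph_dist_eq_0_iff)
    moreover have "graph_dist G u y \<noteq> 0"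
      using graph_dist_eq_0_iff[OF assms in_arcsD2[OF that]] no_loops[OF that] by auto
    ultimately show ?thesis using graph_dist_arc_le[OF assms that] by simp
  qed
  then have "(\<Sum>y | (u, y) \<in> parcs G. f (graph_dist G u y)) = (\<Sum>y | (u, y) \<in> parcs G. f 1)"
    by (intro sum.cong) auto
  then show ?thesis using card_neighbours[OF assms] by simp
qed

text \<open>
  A vertex other than the root has exactly one neighbour closer to the root; all others are one step farther
  away.
\<close>

lemma sum_neighbours_sphere:
  fixes f :: "nat \<Rightarrow> real"
  assumes "u \<in> pverts G" "x \<in> pverts G" "graph_dist G u x = Suc r"
  shows "(\<Sum>y | (x, y) \<in> parcs G. f (graph_dist G u y)) = f r + (real k - 1) * f (Suc (Suc r))"
proof -
  let ?N = "{y. (x, y) \<in> parcs G}"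
  obtain z where z: "(x, z) \<in> parcs G" "graph_dist G u z = r"
    using closer_neighbour_exists[OF assms] .
  have far: "graph_dist G u y = Suc (Suc r)" if "y \<in> ?N - {z}" for y
  proof -
    have xy: "(x, y) \<in> parcs G" and "y \<noteq> z" using that by auto
    then have "\<not> graph_dist G u y \<le> graph_dist G u x"
      using not_farther_neighbour_unique[OF assms(1) xy z(1)] z(2) assms(3) by auto
    then show ?thesis using graph_dist_arc_le[OF assms(1) xy] assms(3) by simp
  qed
  have fin: "finite ?N" and card: "card ?N = k"
    using finite_neighbours card_neighbours assms(2) by auto
  have "k \<ge> 1" using fin z(1) card by (metis (mono_tags) One_nat_def Suc_leI card_gt_0_iff empty_iff mem_Collect_eq)
  have "(\<Sum>y\<in>?N. f (graph_dist G u y)) = f r + (\<Sum>y\<in>?N - {z}. f (graph_dist G u y))"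
    using sum.remove[OF fin, of z "\<lambda>y. f (graph_dist G u y)"] z by simp
  also have "(\<Sum>y\<in>?N - {z}. f (graph_dist G u y)) = (\<Sum>y\<in>?N - {z}. f (Suc (Suc r)))"
    using far by (intro sum.cong) auto
  also have "\<dots> = (real k - 1) * f (Suc (Suc r))"
    using fin z(1) card \<open>k \<ge> 1\<close> by (simp add: of_nat_diff)
  finally show ?thesis .
qed

end

lemma gen_laplacian_laplace_mode:
  assumes "regular_tree G (q + 1)" and "q \<ge> 1" and "d_coeff q a b \<noteq> 0"
    and "u \<in> pverts G" and "x \<in> pverts G"
  shows "gen_laplacian G q a b (\<lambda>y. laplace_mode q a b k (graph_dist G u y)) x
    = - laplace_mode q a b (Suc k) (graph_dist G u x)"
proof -
  interpret regular_tree G "q + 1" by fact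
  let ?m = "laplace_mode q a b k"
  have lap: "gen_laplacian G q a b (\<lambda>y. ?m (graph_dist G u y)) x
      = d_coeff q a b * ?m (graph_dist G u x)
        - b * (\<Sum>y | (x, y) \<in> parcs G. ?m (graph_dist G u y))"
    by (simp add: gen_laplacian_def laplacian_def d_coeff_def algebra_simps)
  show ?thesis
  proof (cases "graph_dist G u x")
    case 0
    then have "x = u" using graph_dist_eq_0_iff assms(4,5) by simp
    then show ?thesis
      unfolding lap using 0 sum_neighbours_root[OF assms(4), of ?m]
        laplace_mode_Suc(1)[OF assms(2,3), of k]
      by (simp add: add.commute)
  next
    case (Suc r)
    show ?thesis
      unfolding lap Suc sum_neighbours_sphere[OF assms(4,5) Suc] laplace_mode_Suc(2)[OF assms(2,3)]
      by simp
  qed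
qed


section \<open>The initial value problem\<close>

lemma gen_laplacian_cong:
  assumes "pair_wf_digraph G" "x \<in> pverts G" "\<And>y. y \<in> pverts G \<Longrightarrow> f y = g y"
  shows "gen_laplacian G q a b f x = gen_laplacian G q a b g x"
proof -
  interpret pair_wf_digraph G by fact
  have "(\<Sum>y | (x, y) \<in> parcs G. f y) = (\<Sum>y | (x, y) \<in> parcs G. g y)"
    using assms(3) by (intro sum.cong) (auto dest: wellformed')
  then show ?thesis using assms(2,3) by (simp add: gen_laplacian_def laplacian_def)
qed

lemma gen_laplacian_sum:
  "gen_laplacian G q a b (\<lambda>y. \<Sum>i\<in>A. c i * f i y) x = (\<Sum>i\<in>A. c i * gen_laplacian G q a b (f i) x)"
proof -
  have "(\<Sum>y | x \<rightarrow>\<^bsub>with_proj G\<^esub> y. \<Sum>i\<in>A. c i * f i y)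
      = (\<Sum>i\<in>A. c i * (\<Sum>y | x \<rightarrow>\<^bsub>with_proj G\<^esub> y. f i y))"
    by (subst sum.swap) (simp add: sum_distrib_left)
  then show ?thesis
    by (simp only: gen_laplacian_def laplacian_def right_diff_distrib sum_subtractf
        sum_distrib_left mult.left_commute)
qed

text \<open>
  The equation at time \<open>t\<close> determines the value at time \<open>t + 2\<close> from those at \<open>t\<close> and \<open>t + 1\<close>.
\<close>

lemma wave_equation_unique:
  assumes wf: "pair_wf_digraph G"
    and "wave_equation G q a b U" "wave_equation G q a b W"
    and "\<And>x. x \<in> pverts G \<Longrightarrow> U x 0 = W x 0"
    and "\<And>x. x \<in> pverts G \<Longrightarrow> fwd_diff (U x) 0 = fwd_diff (W x) 0"
    and "x \<in> pverts G"
  shows "U x t = W x t"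
proof -
  have "\<forall>x\<in>pverts G. U x t = W x t \<and> U x (Suc t) = W x (Suc t)"
  proof (induction t)
    case 0
    then show ?case using assms(4,5) by (fastforce simp: fwd_diff_def)
  next
    case (Suc t)
    show ?case
    proof
      fix x assume x: "x \<in> pverts G"
      have "gen_laplacian G q a b (\<lambda>y. U y t) x = gen_laplacian G q a b (\<lambda>y. W y t) x"
        using Suc by (intro gen_laplacian_cong[OF wf x]) auto
      then have "fwd_diff2 (U x) t = fwd_diff2 (W x) t"
        using assms(2,3) x unfolding wave_equation_def by (metis add_left_cancel)
      then show "U x (Suc t) = W x (Suc t) \<and> U x (Suc (Suc t)) = W x (Suc (Suc t))"
        using Suc x by (simp add: fwd_diff2_def)
    qed
  qed
  then show ?thesis using assms(6) by blast
qed

lemma wave_equation_cong: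
  assumes "pair_wf_digraph G" "\<And>x t. x \<in> pverts G \<Longrightarrow> U x t = W x t"
  shows "wave_equation G q a b U \<longleftrightarrow> wave_equation G q a b W"
  using assms gen_laplacian_cong[OF assms(1), of _ "\<lambda>y. U y _" "\<lambda>y. W y _" q a b]
  by (auto simp: wave_equation_def fwd_diff2_def)

text \<open>
  It is enough to exhibit one solution \<open>S\<close> with the right initial data; uniqueness then gives the equivalence.
\<close>

lemma cauchy_problem_iff:
  assumes wf: "pair_wf_digraph G"
    and "wave_equation G q a b S"
    and "\<forall>x\<in>pverts G. S x 0 = f x" "\<forall>x\<in>pverts G. fwd_diff (S x) 0 = g x"
  shows "wave_equation G q a b W
      \<and> (\<forall>x\<in>pverts G. W x 0 = f x) \<and> (\<forall>x\<in>pverts G. fwd_diff (W x) 0 = g x)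
    \<longleftrightarrow> (\<forall>x\<in>pverts G. \<forall>t. W x t = S x t)"
    (is "?P \<longleftrightarrow> ?Q")
proof
  assume ?P
  then show ?Q using wave_equation_unique[OF wf _ assms(2)] assms(3,4) by simp
next
  assume Q: ?Q
  then have "wave_equation G q a b W" using wave_equation_cong[OF wf] assms(2) by blast
  with Q show ?P using assms(3,4) by (simp add: fwd_diff_def)
qed

text \<open>
  The second forward difference of \<open>t choose m\<close> in \<open>t\<close> is \<open>t choose (m - 2)\<close>, and it is zero for \<open>m \<le> 1\<close>. Here it
  shifts the summation index by one. The case \<open>s = 0\<close> is a discrete cosine series,
  and \<open>s = 1\<close> a discrete sine series.
\<close>

lemma fwd_diff2_binomial_sum:
  fixes u :: "nat \<Rightarrow> real"
  assumes "s \<le> 1"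
  shows "fwd_diff2 (\<lambda>t. \<Sum>k\<le>t. real (t choose (2 * k + s)) * u k) t
    = (\<Sum>k\<le>t. real (t choose (2 * k + s)) * u (Suc k))"
proof -
  have widen_t: "(\<Sum>k\<le>t. real (t choose (2 * k + s)) * u k)
      = (\<Sum>k\<le>Suc (Suc t). real (t choose (2 * k + s)) * u k)"
    and widen_Suc_t: "(\<Sum>k\<le>Suc t. real (Suc t choose (2 * k + s)) * u k)
      = (\<Sum>k\<le>Suc (Suc t). real (Suc t choose (2 * k + s)) * u k)"
    by (rule sum.mono_neutral_left; auto simp: binomial_eq_0)+
  let ?D = "\<lambda>m. real (Suc (Suc t) choose m) - 2 * real (Suc t choose m) + real (t choose m)"
  have low: "?D s = 0" using assms by (cases s) simp_all
  have high: "?D (Suc (Suc m)) = real (t choose m)" for m by simp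
  have "fwd_diff2 (\<lambda>t. \<Sum>k\<le>t. real (t choose (2 * k + s)) * u k) t
      = (\<Sum>k\<le>Suc (Suc t). ?D (2 * k + s) * u k)"
    unfolding fwd_diff2_def add_2_eq_Suc' Suc_eq_plus1[symmetric] widen_t widen_Suc_t
    by (simp add: sum.distrib sum_subtractf sum_distrib_left algebra_simps
        del: sum.atMost_Suc binomial_Suc_Suc)
  also have "\<dots> = (\<Sum>k\<le>Suc t. ?D (Suc (Suc (2 * k + s))) * u (Suc k))"
    using low by (subst sum.atMost_Suc_shift) (simp del: sum.atMost_Suc binomial_Suc_Suc)
  also have "\<dots> = (\<Sum>k\<le>t. real (t choose (2 * k + s)) * u (Suc k))"
    unfolding high by (simp add: binomial_eq_0)
  finally show ?thesis .
qed

lemma wave_equation_binomial_series: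
  assumes "s \<le> 1"
    and "\<And>k x. x \<in> pverts G \<Longrightarrow> gen_laplacian G q a b (u k) x = - u (Suc k) x"
  shows "wave_equation G q a b (\<lambda>x t. \<Sum>k\<le>t. real (t choose (2 * k + s)) * u k x)"
  unfolding wave_equation_def
  by (simp add: gen_laplacian_sum assms fwd_diff2_binomial_sum[OF assms(1)] sum_negf)

lemma wave_W_eq:
  "wave_W q a b r t = (\<Sum>k\<le>t. real (t choose (2 * k)) * laplace_mode q a b k r)"
proof -
  have "wave_W q a b r t = (\<Sum>k = 0..t div 2. real (t choose (2 * k)) * laplace_mode q a b k r)"
    by (simp add: wave_W_def laplace_mode_def mult_ac)
  also have "\<dots> = (\<Sum>k\<le>t. real (t choose (2 * k)) * laplace_mode q a b k r)"
    by (rule sum.mono_neutral_left) (auto simp: binomial_eq_0)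
  finally show ?thesis .
qed

lemma wave_V_eq:
  "wave_V q a b r t = (\<Sum>k\<le>t. real (t choose (2 * k + 1)) * laplace_mode q a b k r)"
proof -
  have "wave_V q a b r t
      = (\<Sum>k | int k \<le> (int t - 1) div 2. real (t choose (2 * k + 1)) * laplace_mode q a b k r)"
    by (simp add: wave_V_def laplace_mode_def mult_ac)
  also have "\<dots> = (\<Sum>k\<le>t. real (t choose (2 * k + 1)) * laplace_mode q a b k r)"
    by (rule sum.mono_neutral_left) (auto intro!: binomial_eq_0)
  finally show ?thesis .
qed

theorem theorem1p1:
  fixes G :: "'v pair_pre_digraph" and x\<^sub>0 :: 'v and q :: nat and a b :: real
    and W V :: "'v \<Rightarrow> nat \<Rightarrow> real"
  assumes "q \<ge> 1"
    and "b \<noteq> 0"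
    and "b * (real q + 1) - a \<ge> 2 * \<bar>b\<bar> * sqrt (real q)"
    and "regular_tree G (q + 1)"
    and "x\<^sub>0 \<in> pverts G"
  shows
    "(wave_equation G q a b W
        \<and> (\<forall>x\<in>pverts G. W x 0 = delta x\<^sub>0 x)
        \<and> (\<forall>x\<in>pverts G. fwd_diff (W x) 0 = 0)
      \<longleftrightarrow> (\<forall>x\<in>pverts G. \<forall>t. W x t = wave_W q a b (graph_dist G x\<^sub>0 x) t))
     \<and>
     (wave_equation G q a b V
        \<and> (\<forall>x\<in>pverts G. V x 0 = 0)
        \<and> (\<forall>x\<in>pverts G. fwd_diff (V x) 0 = delta x\<^sub>0 x)
      \<longleftrightarrow> (\<forall>x\<in>pverts G. \<forall>t. V x t = wave_V q a b (graph_dist G x\<^sub>0 x) t))"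
proof -
  interpret regular_tree G "q + 1" by fact
  have wf: "pair_wf_digraph G" by unfold_locales
  have "2 * \<bar>b\<bar> * sqrt (real q) > 0" using assms(1,2) by simp
  then have d: "d_coeff q a b \<noteq> 0" using assms(3) unfolding d_coeff_def by linarith
  let ?u = "\<lambda>k x. laplace_mode q a b k (graph_dist G x\<^sub>0 x)"
  have lap: "gen_laplacian G q a b (?u k) x = - ?u (Suc k) x" if "x \<in> pverts G" for k x
    by (rule gen_laplacian_laplace_mode[OF assms(4,1) d assms(5) that])
  have init: "?u 0 x = delta x\<^sub>0 x" if "x \<in> pverts G" for x
    using graph_dist_eq_0_iff[OF assms(5) that]
    by (auto simp: laplace_mode_def delta_def bessel_factor_at_0[OF assms(1)])
  show ?thesis
  proof (intro conjI; rule cauchy_problem_iff[OF wf])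
    show "wave_equation G q a b (\<lambda>x. wave_W q a b (graph_dist G x\<^sub>0 x))"
      using wave_equation_binomial_series[where s = 0 and u = ?u, OF _ lap] by (simp add: wave_W_eq[abs_def])
    show "wave_equation G q a b (\<lambda>x. wave_V q a b (graph_dist G x\<^sub>0 x))"
      using wave_equation_binomial_series[where s = 1 and u = ?u, OF _ lap] by (simp add: wave_V_eq[abs_def])
  qed (use init in \<open>simp_all add: wave_W_eq wave_V_eq fwd_diff_def\<close>)
qed

end
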